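(* Let $\mathcal{F}=\mathbb{C}\langle x_1,\dots,x_n,x_1^*,\dots,x_n^*\rangle$ be a free $*$-algebra, let $k\ge1$, and let $L_k\in V_{2k}^*$ be a positive semidefinite tip-maximal truncated functional on $\mathcal{F}$. Then $L_k$ has a positive semidefinite extension to a linear functional $L$ on $\mathcal{F}$.
   Context: $\mathcal{F}$ is the free unital complex associative algebra on the letters $x_1,\dots,x_n,x_1^*,\dots,x_n^*$, with the conjugate-linear anti-multiplicative involution exchanging $x_i$ and $x_i^*$. Its basis $\mathcal{B}$ consists of all words in these letters, including the empty word $1$; $|a|$ is the length of the word $a$. For $k\ge 0$ put $S_k=\{a\in\mathcal{B}:|a|\le k\}$, $V_k=\operatorname{Span}(S_k)$, and let $V_k^*$ be the dual space of $V_k$. For $L_k\in V_{2k}^*$ define $B_{L_k}\colon V_k\times V_k\to\mathbb{C}$ by $B_{L_k}(p,q)=L_k(pq^* )$, and $\ker B_{L_k}=\{p\in V_k: B_{L_k}(p,q)=0\ \text{for all } q\in V_k\}$. $L_k$ is hermitian if $L_k(a^* )=\overline{L_k(a)}$ for all $a\in V_{2k}$. A hermitian functional $L_k\in V_{2k}^*$ is called tip-maximal if there is a set $p_1,\dots,p_r$ spanning $\ker B_{L_k}$ such that the projections $f_1,\dots,f_r$ of $p_1,\dots,p_r$ onto $\operatorname{Span}(S_k\setminus S_{k-1})$ parallel to $\operatorname{Span}(S_{k-1})$ are linearly independent (in particular, $L_k$ is tip-maximal if $B_{L_k}$ is non-degenerate, the case $r=0$). $L_k$ is positive semidefinite if $L_k(pp^*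 )\ge0$ for all $p\in V_k$; a linear functional $L$ on $\mathcal{F}$ is positive semidefinite if $L(pp^* )\ge 0$ for all $p\in\mathcal{F}$. *)

theory Defs
  imports "HOL-Analysis.Analysis" "HOL-Library.Poly_Mapping" "HOL-Library.Nonpos_Ints"
begin

abbreviation lookup :: "('a \<Rightarrow>\<^sub>0 'b::zero) \<Rightarrow> 'a \<Rightarrow> 'b"
  where "lookup \<equiv> Poly_Mapping.lookup"

abbreviation keys :: "('a \<Rightarrow>\<^sub>0 'b::zero) \<Rightarrow> 'a set"
  where "keys \<equiv> Poly_Mapping.keys"

datatype 'n letter = Gen 'n | Adj 'n

text \<open>
  Words are lists of letters, written additively under concatenation. This makes
  \<open>Poly_Mapping\<close> supply the ring structure of the free algebra (convolution product), whose
  basis element for the word \<open>w\<close> is \<open>Poly_Mapping.single w 1\<close>.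
\<close>

instantiation list :: (type) monoid_add
begin

definition zero_list :: "'a list" where "zero_list = []"

definition plus_list :: "'a list \<Rightarrow> 'a list \<Rightarrow> 'a list" where "plus_list u v = u @ v"

instance by standard (simp_all add: zero_list_def plus_list_def)

end

type_synonym 'n word = "'n letter list"
type_synonym 'n free_alg = "'n letter list \<Rightarrow>\<^sub>0 complex"

definition monom :: "'n word \<Rightarrow> 'n free_alg"
  where "monom w = Poly_Mapping.single w 1"

definition scale :: "complex \<Rightarrow> 'n free_alg \<Rightarrow> 'n free_alg"
  where "scale c p = Poly_Mapping.map ((*) c) p"

lemma lookup_scale [simp]: "lookup (scale c p) w = c * lookup p w"
  by (simp add: scale_def Poly_Mapping.map.rep_eq when_def)

global_interpretation fa: vector_space scale
  by standard (auto intro!: poly_mapping_eqI simp: lookup_add algebra_simps)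

fun letter_star :: "'n letter \<Rightarrow> 'n letter"
  where
    "letter_star (Gen i) = Adj i"
  | "letter_star (Adj i) = Gen i"

definition word_star :: "'n word \<Rightarrow> 'n word"
  where "word_star w = rev (map letter_star w)"

definition star :: "'n free_alg \<Rightarrow> 'n free_alg"
  where "star p = (\<Sum>w \<in> keys p. Poly_Mapping.single (word_star w) (cnj (lookup p w)))"

lemma letter_star_letter_star [simp]: "letter_star (letter_star x) = x"
  by (cases x) auto

lemma word_star_word_star [simp]: "word_star (word_star w) = w"
  by (simp add: word_star_def rev_map comp_def)

lemma word_star_add: "word_star (u + v) = word_star v + word_star u"
  by (simp add: word_star_def plus_list_def)

lemma lookup_star: "lookup (star p) w = cnj (lookup p (word_star w))"
proof -
  have "lookup (star p) w =
      (\<Sum>v \<in> keys p. if v = word_star w then cnj (lookup p v) else 0)"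
    unfolding star_def lookup_sum
    by (rule sum.cong) (auto simp: lookup_single when_def)
  then show ?thesis
    by (simp add: in_keys_iff)
qed

lemma star_star: "star (star p) = p"
  by (rule poly_mapping_eqI) (simp add: lookup_star)

lemma star_add: "star (p + q) = star p + star q"
  by (rule poly_mapping_eqI) (simp add: lookup_star lookup_add)

lemma star_scale: "star (scale c p) = scale (cnj c) (star p)"
  by (rule poly_mapping_eqI) (simp add: lookup_star)

lemma star_single: "star (Poly_Mapping.single w c) = Poly_Mapping.single (word_star w) (cnj c)"
  by (rule poly_mapping_eqI) (auto simp: lookup_star lookup_single when_def)

lemma star_mult: "star (p * q) = star q * star p"
proof -
  have sum_star: "star (sum f A) = (\<Sum>a\<in>A. star (f a))" for f :: "'b \<Rightarrow> 'a free_alg" and A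
  proof (rule poly_mapping_eqI)
    show "lookup (star (sum f A)) w = lookup (\<Sum>a\<in>A. star (f a)) w" for w
      by (simp add: lookup_star lookup_sum)
  qed
  have rep: "r = (\<Sum>w\<in>keys r. Poly_Mapping.single w (lookup r w))" for r :: "'a free_alg"
  proof (rule poly_mapping_eqI)
    fix v
    have "lookup (\<Sum>w\<in>keys r. Poly_Mapping.single w (lookup r w)) v =
        (\<Sum>w\<in>keys r. if w = v then lookup r w else 0)"
      unfolding lookup_sum by (rule sum.cong) (auto simp: lookup_single when_def)
    then show "lookup r v = lookup (\<Sum>w\<in>keys r. Poly_Mapping.single w (lookup r w)) v"
      by (simp add: in_keys_iff)
  qed
  have "p * q = (\<Sum>u\<in>keys p. \<Sum>v\<in>keys q. Poly_Mapping.single (u + v) (lookup p u * lookup q v))"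
    by (subst rep[of p], subst rep[of q]) (simp add: sum_product mult_single)
  then have "star (p * q) =
      (\<Sum>u\<in>keys p. \<Sum>v\<in>keys q.
        Poly_Mapping.single (word_star v + word_star u) (cnj (lookup q v) * cnj (lookup p u)))"
    by (simp add: sum_star star_single word_star_add mult.commute)
  also have "\<dots> = star q * star p"
    by (subst sum.swap) (simp add: star_def sum_product mult_single)
  finally show ?thesis .
qed

definition S :: "nat \<Rightarrow> 'n word set"
  where "S k = {w. length w \<le> k}"

definition V :: "nat \<Rightarrow> 'n free_alg set"
  where "V k = fa.span (monom ` S k)"

text \<open>
  A functional on \<open>V m\<close> is a function on the whole algebra that is linear on \<open>V m\<close>; its values
  outside \<open>V m\<close> are irrelevant.
\<close>

definition functional_on :: "nat \<Rightarrow> ('n free_alg \<Rightarrow> complex) \<Rightarrow> bool"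
  where "functional_on m L \<longleftrightarrow>
    (\<forall>p \<in> V m. \<forall>q \<in> V m. L (p + q) = L p + L q) \<and>
    (\<forall>c. \<forall>p \<in> V m. L (scale c p) = c * L p)"

definition hermitian :: "nat \<Rightarrow> ('n free_alg \<Rightarrow> complex) \<Rightarrow> bool"
  where "hermitian k L \<longleftrightarrow> (\<forall>p \<in> V (2 * k). L (star p) = cnj (L p))"

definition form :: "('n free_alg \<Rightarrow> complex) \<Rightarrow> 'n free_alg \<Rightarrow> 'n free_alg \<Rightarrow> complex"
  where "form L p q = L (p * star q)"

definition form_ker :: "nat \<Rightarrow> ('n free_alg \<Rightarrow> complex) \<Rightarrow> 'n free_alg set"
  where "form_ker k L = {p \<in> V k. \<forall>q \<in> V k. form L p q = 0}"

definition psd_on :: "nat \<Rightarrow> ('n free_alg \<Rightarrow> complex) \<Rightarrow> bool"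
  where "psd_on k L \<longleftrightarrow> (\<forall>p \<in> V k. L (p * star p) \<in> \<real>\<^sub>\<ge>\<^sub>0)"

definition psd :: "('n free_alg \<Rightarrow> complex) \<Rightarrow> bool"
  where "psd L \<longleftrightarrow> (\<forall>p. L (p * star p) \<in> \<real>\<^sub>\<ge>\<^sub>0)"

text \<open>
  On \<open>V k\<close>, discarding the words of length other than \<open>k\<close> is the projection onto the span of
  \<open>S k - S (k - 1)\<close> parallel to the span of \<open>S (k - 1)\<close>; see \<open>tip_projection\<close> below.
\<close>

definition tip :: "nat \<Rightarrow> 'n free_alg \<Rightarrow> 'n free_alg"
  where "tip k p = (\<Sum>w \<in> {w \<in> keys p. length w = k}. Poly_Mapping.single w (lookup p w))"

lemma lookup_tip: "lookup (tip k p) w = (if length w = k then lookup p w else 0)"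
proof -
  have "lookup (tip k p) w =
      (\<Sum>v \<in> {v \<in> keys p. length v = k}. if v = w then lookup p v else 0)"
    unfolding tip_def lookup_sum by (rule sum.cong) (auto simp: lookup_single when_def)
  then show ?thesis
    by (auto simp: in_keys_iff)
qed

lemma span_monom:
  fixes A :: "'n word set"
  shows "fa.span (monom ` A) = {p. keys p \<subseteq> A}"
proof (intro equalityI subsetI)
  fix p assume "p \<in> fa.span (monom ` A)"
  then show "p \<in> {p. keys p \<subseteq> A}"
  proof (induction rule: fa.span_induct)
    case base
    show ?case
      unfolding fa.subspace_def
      by (auto simp: in_keys_iff lookup_add subset_iff) (metis add_0)
  next
    case (step x)
    then show ?case by (auto simp: monom_def)
  qed
next
  fix p :: "'n free_alg" assume p: "p \<in> {p. keys p \<subseteq> A}"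
  have "p = (\<Sum>w\<in>keys p. scale (lookup p w) (monom w))"
  proof (rule poly_mapping_eqI)
    fix v
    have "lookup (\<Sum>w\<in>keys p. scale (lookup p w) (monom w)) v =
        (\<Sum>w\<in>keys p. if w = v then lookup p w else 0)"
      unfolding lookup_sum by (rule sum.cong) (auto simp: monom_def lookup_single when_def)
    then show "lookup p v = lookup (\<Sum>w\<in>keys p. scale (lookup p w) (monom w)) v"
      by (simp add: in_keys_iff)
  qed
  also have "\<dots> \<in> fa.span (monom ` A)"
    using p by (intro fa.span_sum fa.span_scale fa.span_base) auto
  finally show "p \<in> fa.span (monom ` A)" .
qed

lemma tip_projection:
  assumes "k \<ge> 1" "p \<in> V k"
  shows "f = tip k p \<longleftrightarrow> f \<in> fa.span (monom ` (S k - S (k - 1))) \<and> p - f \<in> V (k - 1)"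
proof
  assume "f = tip k p"
  with assms show "f \<in> fa.span (monom ` (S k - S (k - 1))) \<and> p - f \<in> V (k - 1)"
    unfolding V_def span_monom
    by (auto simp: S_def in_keys_iff lookup_tip lookup_minus subset_iff split: if_splits)
next
  assume f: "f \<in> fa.span (monom ` (S k - S (k - 1))) \<and> p - f \<in> V (k - 1)"
  show "f = tip k p"
  proof (rule poly_mapping_eqI)
    fix w
    show "lookup f w = lookup (tip k p) w"
    proof (cases "length w = k")
      case True
      with f assms(1) have "w \<notin> keys (p - f)"
        unfolding V_def span_monom by (auto simp: S_def)
      with True show ?thesis
        by (simp add: lookup_tip in_keys_iff lookup_minus)
    next
      case False
      with f assms(1) have "w \<notin> keys f"
        unfolding span_monom by (auto simp: S_def)
      with False show ?thesis
        by (simp add: lookup_tip in_keys_iff)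
    qed
  qed
qed

text \<open>
  Injectivity of \<open>tip k\<close> on \<open>P\<close> is part of the linear independence of the tips as a family: two
  elements of \<open>P\<close> with the same tip are not allowed.
\<close>

definition tip_maximal :: "nat \<Rightarrow> ('n free_alg \<Rightarrow> complex) \<Rightarrow> bool"
  where "tip_maximal k L \<longleftrightarrow> hermitian k L \<and>
    (\<exists>P. finite P \<and> fa.span P = form_ker k L \<and>
      inj_on (tip k) P \<and> fa.independent (tip k ` P))"

end

theory Submission
  imports Defs
begin

text \<open>
  Tip-maximality makes the form positive definite on \<open>V (k - 1)\<close>. Hence right multiplication by a
  letter, which is only defined there, extends to an operator on \<open>V k\<close>: on the orthogonal complement
  of \<open>V (k - 1)\<close> take the adjoint of right multiplication by the starred letter, compressed to
  \<open>V (k - 1)\<close>. These operators are adjoint to each other for starred letters, and \<open>L\<close> is the vector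
  state at \<open>1\<close> of the representation that they generate.
\<close>

section \<open>Words, the involution and the filtration by degree\<close>

lemma monom_mult: "monom u * monom v = monom (u @ v)"
  by (simp add: monom_def mult_single plus_list_def)

lemma monom_Nil: "monom [] = 1"
  by (simp add: monom_def flip: zero_list_def)

lemma star_monom: "star (monom w) = monom (word_star w)"
  by (simp add: monom_def star_single)

lemma star_diff: "star (p - q) = star p - star q"
  by (rule poly_mapping_eqI) (simp add: lookup_star lookup_minus)

lemma scale_mult_left: "scale c p * q = scale c (p * q)"
  by (simp add: scale_def mult_map_scale_conv_mult mult.assoc)

text \<open>The involution reduces this to \<open>scale_mult_left\<close>: it swaps factors and
  conjugates scalars.\<close>

lemma scale_mult_right: "p * scale c q = scale c (p * q)"
  by (metis scale_mult_left star_mult star_scale star_star)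

lemma sum_scale_monom:
  assumes "finite A" "keys p \<subseteq> A"
  shows "(\<Sum>w\<in>A. scale (lookup p w) (monom w)) = p"
proof (rule poly_mapping_eqI)
  fix v
  have "lookup (\<Sum>w\<in>A. scale (lookup p w) (monom w)) v = (\<Sum>w\<in>A. if w = v then lookup p w else 0)"
    unfolding lookup_sum by (rule sum.cong) (auto simp: monom_def lookup_single when_def)
  then show "lookup (\<Sum>w\<in>A. scale (lookup p w) (monom w)) v = lookup p v"
    using assms by (auto simp: in_keys_iff)
qed

lemma V_iff: "p \<in> V k \<longleftrightarrow> keys p \<subseteq> S k"
  by (simp add: V_def span_monom)

lemma V_add: "p \<in> V k \<Longrightarrow> q \<in> V k \<Longrightarrow> p + q \<in> V k"
  by (simp add: V_def fa.span_add)

lemma V_diff: "p \<in> V k \<Longrightarrow> q \<in> V k \<Longrightarrow> p - q \<in> V k"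
  by (simp add: V_def fa.span_diff)

lemma V_scale: "p \<in> V k \<Longrightarrow> scale c p \<in> V k"
  by (simp add: V_def fa.span_scale)

lemma V_sum: "(\<And>i. i \<in> A \<Longrightarrow> f i \<in> V k) \<Longrightarrow> sum f A \<in> V k"
  by (simp add: V_def fa.span_sum)

lemma V_mono: "k \<le> l \<Longrightarrow> p \<in> V k \<Longrightarrow> p \<in> V l"
  by (fastforce simp: V_iff S_def)

lemma monom_in_V: "monom w \<in> V k \<longleftrightarrow> length w \<le> k"
  by (simp add: V_iff S_def monom_def)

lemma V_mult:
  assumes "p \<in> V k" "q \<in> V l"
  shows "p * q \<in> V (k + l)"
proof -
  have "keys (p * q) \<subseteq> {u + v | u v. u \<in> keys p \<and> v \<in> keys q}"
    by (rule keys_mult)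
  also have "\<dots> \<subseteq> S (k + l)"
    using assms by (fastforce simp: V_iff S_def plus_list_def)
  finally show ?thesis
    by (simp add: V_iff)
qed

lemma V_star:
  assumes "p \<in> V k"
  shows "star p \<in> V k"
proof -
  have "length (word_star w) = length w" for w :: "'a word"
    by (simp add: word_star_def)
  with assms show ?thesis
    unfolding V_iff S_def by (force simp: in_keys_iff lookup_star subset_iff)
qed

text \<open>Finitely many generators give a finite alphabet. This lets \<open>riesz_exists\<close>
  be applied to all of \<open>S m\<close> and makes the sum in \<open>cutoff\<close> a finite
  one.\<close>

lemma finite_S: "finite (S k :: 'n::finite word set)"
proof -
  have "(UNIV :: 'n letter set) = range Gen \<union> range Adj"
    by (metis UNIV_eq_I UnI1 UnI2 letter.exhaust rangeI)
  then have "finite (UNIV :: 'n letter set)"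
    by (metis finite_UnI finite_imageI finite)
  then show ?thesis
    using finite_lists_length_le[of "UNIV :: 'n letter set" k] by (simp add: S_def)
qed


section \<open>Linear functionals and their forms\<close>

locale free_alg_functional =
  fixes L :: "'n free_alg \<Rightarrow> complex"
  assumes L_add: "L (p + q) = L p + L q"
    and L_scale: "L (scale c p) = c * L p"
begin

lemma L_zero: "L 0 = 0"
  using L_scale[of 0 0] by simp

lemma L_diff: "L (p - q) = L p - L q"
  using L_add[of "p - q" q] by simp

lemma L_sum: "L (sum f A) = (\<Sum>i\<in>A. L (f i))"
  by (induction A rule: infinite_finite_induct) (simp_all add: L_zero L_add)

lemma form_add_left: "form L (p + q) r = form L p r + form L q r"
  by (simp add: form_def distrib_right L_add)

lemma form_add_right: "form L r (p + q) = form L r p + form L r q"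
  by (simp add: form_def distrib_left L_add star_add)

lemma form_diff_left: "form L (p - q) r = form L p r - form L q r"
  by (simp add: form_def left_diff_distrib L_diff)

lemma form_diff_right: "form L r (p - q) = form L r p - form L r q"
  by (simp add: form_def right_diff_distrib L_diff star_diff)

lemma form_scale_left: "form L (scale c p) q = c * form L p q"
  by (simp add: form_def scale_mult_left L_scale)

lemma form_scale_right: "form L p (scale c q) = cnj c * form L p q"
  by (simp add: form_def scale_mult_right L_scale star_scale)

lemma form_zero_left: "form L 0 p = 0"
  using form_diff_left[of 0 0 p] by simp

lemma form_zero_right: "form L p 0 = 0"
  using form_diff_right[of p 0 0] by simp

lemma form_sum_left: "form L (sum f A) q = (\<Sum>u\<in>A. form L (f u) q)"
  by (simp add: form_def sum_distrib_right L_sum)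

lemma form_sum_right: "form L p (sum g B) = (\<Sum>v\<in>B. form L p (g v))"
  by (induction B rule: infinite_finite_induct) (simp_all add: form_zero_right form_add_right)

lemma form_sum_scale:
  "form L (\<Sum>u\<in>A. scale (c u) (f u)) (\<Sum>v\<in>B. scale (d v) (g v)) =
    (\<Sum>u\<in>A. \<Sum>v\<in>B. c u * cnj (d v) * form L (f u) (g v))"
proof -
  have "form L (\<Sum>u\<in>A. scale (c u) (f u)) q = (\<Sum>u\<in>A. c u * form L (f u) q)" for q
    by (simp add: form_sum_left form_scale_left)
  moreover have "form L (f u) (\<Sum>v\<in>B. scale (d v) (g v)) = (\<Sum>v\<in>B. cnj (d v) * form L (f u) (g v))" for u
    by (simp add: form_sum_right form_scale_right)
  ultimately show ?thesis
    by (simp add: sum_distrib_left mult.assoc)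
qed

lemma form_mult_monom: "form L (p * monom w) q = form L p (q * monom (word_star w))"
  by (simp add: form_def star_mult star_monom mult.assoc)

lemma form_monom_monom: "form L (monom u) (monom v) = L (monom (u @ word_star v))"
  by (simp add: form_def star_monom monom_mult)

text \<open>Both sides are conjugate-linear in the second argument, so agreement on words passes to
  their span.\<close>

lemma form_span_eq:
  assumes "\<And>w. w \<in> A \<Longrightarrow> form L u (monom w) = form L v (monom w)"
    and "q \<in> fa.span (monom ` A)"
  shows "form L u q = form L v q"
  using assms(2)
proof (induction rule: fa.span_induct_alt)
  case base
  show ?case by (simp add: form_zero_right)
next
  case (step c x y)
  then show ?case
    using assms(1) by (auto simp: form_add_right form_scale_right)
qed

lemma linear_L: "Vector_Spaces.linear scale (*) L"
  by (intro Vector_Spaces.linear_iff[THEN iffD2] conjI allI L_add L_scale fa.vector_space_axioms)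
    (unfold_locales, auto simp: algebra_simps)

end

locale hermitian_functional = free_alg_functional +
  assumes L_star: "L (star p) = cnj (L p)"
begin

lemma form_cnj: "cnj (form L p q) = form L q p"
  using L_star[of "p * star q"] by (simp add: form_def star_mult star_star)

text \<open>The case of the Cauchy-Schwarz inequality in which one side vanishes.\<close>

lemma form_eq_0_if_isotropic:
  assumes nonneg: "\<And>p. p \<in> V k \<Longrightarrow> form L p p \<in> \<real>\<^sub>\<ge>\<^sub>0"
    and "p \<in> V k" "q \<in> V k" "form L p p = 0"
  shows "form L p q = 0"
proof -
  define b where "b = form L p q"
  \<comment> \<open>If \<open>b\<close> is nonzero, \<open>t * (cmod b)\<^sup>2\<close> exceeds
    \<open>Re (form L q q)\<close> by one, which makes the form of \<open>scale c p + q\<close>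
    negative.\<close>
  define t where "t = (Re (form L q q) + 1) / (cmod b)\<^sup>2"
  define c where "c = - (of_real t * cnj b)"
  have "scale c p + q \<in> V k"
    using assms by (simp add: V_add V_scale)
  then have "0 \<le> Re (form L (scale c p + q) (scale c p + q))"
    using nonneg complex_nonneg_Reals_iff by blast
  also have "form L (scale c p + q) (scale c p + q) = c * b + cnj (c * b) + form L q q"
    using assms(4) form_cnj[of p q]
    by (simp add: form_add_left form_add_right form_scale_left form_scale_right b_def)
  also have "c * b = of_real (- t * (cmod b)\<^sup>2)"
    using complex_norm_square[of b] by (simp add: c_def mult_ac)
  finally have "t * (cmod b)\<^sup>2 * 2 \<le> Re (form L q q)"
    by simp
  moreover have "0 \<le> Re (form L q q)"
    using nonneg assms(3) complex_nonneg_Reals_iff by blast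
  ultimately have "b = 0"
    by (cases "b = 0") (auto simp: t_def)
  then show ?thesis
    by (simp add: b_def)
qed

end


section \<open>The extension of a functional with definite form\<close>

text \<open>Here \<open>m\<close> stands for \<open>k - 1\<close>: definiteness is available one
  degree below the space \<open>V (Suc m)\<close> on which the operators will act.\<close>

locale definite_functional = hermitian_functional L for L :: "'n::finite free_alg \<Rightarrow> complex" +
  fixes m :: nat
  assumes definite: "p \<in> V m \<Longrightarrow> form L p p = 0 \<Longrightarrow> p = 0"
begin

text \<open>Gram-Schmidt, one word at a time: the solution \<open>u\<close> for \<open>A\<close> is
  corrected by a multiple of \<open>e\<close>, the part of the new word orthogonal to the span of
  \<open>A\<close>. Finding \<open>e\<close> takes a second use of the induction hypothesis, with
  other values in place of \<open>g\<close>.\<close>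

lemma riesz_exists:
  assumes "finite A" "A \<subseteq> S m"
  shows "\<exists>u \<in> fa.span (monom ` A). \<forall>w\<in>A. form L u (monom w) = g w"
  using assms
proof (induction A arbitrary: g rule: finite_induct)
  case empty
  then show ?case by (auto intro: fa.span_zero)
next
  case (insert b A)
  obtain u where u: "u \<in> fa.span (monom ` A)" "\<forall>w\<in>A. form L u (monom w) = g w"
    using insert.IH[of g] insert.prems by auto
  obtain v where v: "v \<in> fa.span (monom ` A)" "\<forall>w\<in>A. form L v (monom w) = form L (monom b) (monom w)"
    using insert.IH[of "\<lambda>w. form L (monom b) (monom w)"] insert.prems by auto
  define e where "e = monom b - v"
  have e_orth: "form L e (monom w) = 0" if "w \<in> A" for w
    using v(2) that by (simp add: e_def form_diff_left)
  have span_mono: "fa.span (monom ` A) \<subseteq> fa.span (monom ` insert b A)"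
    by (intro fa.span_mono) auto
  have e_span: "e \<in> fa.span (monom ` insert b A)"
    unfolding e_def using v(1) span_mono by (intro fa.span_diff) (auto intro: fa.span_base)
  \<comment> \<open>The coefficient of \<open>b\<close> shows that \<open>e\<close> is nonzero, so
    definiteness permits division by \<open>form L e e\<close>.\<close>
  have "b \<notin> keys v"
    using v(1) insert.hyps(2) by (auto simp: span_monom)
  then have "lookup e b = 1"
    by (simp add: e_def lookup_minus monom_def in_keys_iff)
  then have "e \<noteq> 0" by auto
  moreover have "e \<in> V m"
    using e_span insert.prems by (auto simp: V_iff span_monom simp del: image_insert)
  ultimately have ee: "form L e e \<noteq> 0"
    using definite by blast
  have "form L e v = form L 0 v"
    by (rule form_span_eq[OF _ v(1)]) (simp add: e_orth form_zero_left)
  then have eb: "form L e (monom b) = form L e e"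
    by (simp add: e_def form_diff_right form_zero_left)
  define c where "c = (g b - form L u (monom b)) / form L e e"
  have "u + scale c e \<in> fa.span (monom ` insert b A)"
    using u(1) e_span span_mono by (intro fa.span_add fa.span_scale) auto
  moreover have "\<forall>w\<in>insert b A. form L (u + scale c e) (monom w) = g w"
    using u(2) e_orth ee by (auto simp: form_add_left form_scale_left eb c_def)
  ultimately show ?case by blast
qed

definition riesz :: "('n word \<Rightarrow> complex) \<Rightarrow> 'n free_alg"
  where "riesz g = (SOME u. u \<in> V m \<and> (\<forall>w \<in> S m. form L u (monom w) = g w))"

lemma riesz_in_V: "riesz g \<in> V m"
  and form_riesz: "w \<in> S m \<Longrightarrow> form L (riesz g) (monom w) = g w"
proof -
  have "\<exists>u. u \<in> V m \<and> (\<forall>w \<in> S m. form L u (monom w) = g w)"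
    using riesz_exists[OF finite_S order_refl] by (auto simp: V_def)
  from someI_ex[OF this, folded riesz_def]
  show "riesz g \<in> V m" "w \<in> S m \<Longrightarrow> form L (riesz g) (monom w) = g w"
    by auto
qed

text \<open>The difference of two solutions lies in \<open>V m\<close> and is orthogonal to it,
  hence is isotropic and vanishes.\<close>

lemma riesz_unique:
  assumes "u \<in> V m" "\<And>w. w \<in> S m \<Longrightarrow> form L u (monom w) = g w"
  shows "riesz g = u"
proof -
  have d: "riesz g - u \<in> V m"
    by (simp add: V_diff riesz_in_V assms(1))
  have "form L (riesz g) (riesz g - u) = form L u (riesz g - u)"
    by (rule form_span_eq[OF _ d[unfolded V_def]]) (simp add: assms(2) form_riesz)
  then have "form L (riesz g - u) (riesz g - u) = 0"
    by (simp add: form_diff_left)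
  then show ?thesis
    using definite[OF d] by simp
qed

section \<open>Shift operators and their adjoints\<close>

definition proj :: "'n free_alg \<Rightarrow> 'n free_alg"
  where "proj p = riesz (\<lambda>w. form L p (monom w))"

text \<open>The adjoint of right multiplication by \<open>letter_star x\<close> on
  \<open>V m\<close>. As the letter is attached to \<open>w\<close>, an argument from
  \<open>V (Suc m)\<close> is paired only with elements of \<open>V (Suc m)\<close>.\<close>

definition coshift :: "'n letter \<Rightarrow> 'n free_alg \<Rightarrow> 'n free_alg"
  where "coshift x p = riesz (\<lambda>w. form L p (monom w * monom [letter_star x]))"

definition shift :: "'n letter \<Rightarrow> 'n free_alg \<Rightarrow> 'n free_alg"
  where "shift x p = proj p * monom [x] + coshift x (p - proj p)"

lemma proj_in_V: "proj p \<in> V m"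
  by (simp add: proj_def riesz_in_V)

lemma coshift_in_V: "coshift x p \<in> V m"
  by (simp add: coshift_def riesz_in_V)

lemma form_proj: "q \<in> V m \<Longrightarrow> form L (proj p) q = form L p q"
  unfolding V_def by (erule form_span_eq[rotated]) (simp add: proj_def form_riesz)

lemma form_coshift:
  assumes "q \<in> V m"
  shows "form L (coshift x p) q = form L p (q * monom [letter_star x])"
proof -
  \<comment> \<open>With the letter moved onto \<open>p\<close>, the second argument is
    \<open>q\<close> itself and \<open>form_span_eq\<close> applies.\<close>
  have "form L (coshift x p) q = form L (p * monom [x]) q"
    using assms unfolding V_def
    by (rule form_span_eq[rotated])
      (simp add: coshift_def form_riesz form_mult_monom[of _ "[x]"] word_star_def)
  then show ?thesis
    by (simp add: form_mult_monom[of _ "[x]"] word_star_def)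
qed

lemma proj_id: "p \<in> V m \<Longrightarrow> proj p = p"
  unfolding proj_def by (rule riesz_unique) auto

lemma coshift_zero: "coshift x 0 = 0"
  unfolding coshift_def by (rule riesz_unique) (simp_all add: form_zero_left V_def fa.span_zero)

lemma shift_eq_mult: "p \<in> V m \<Longrightarrow> shift x p = p * monom [x]"
  by (simp add: shift_def proj_id coshift_zero)

text \<open>The product raises the degree of an element of \<open>V m\<close> by at most one, and
  \<open>coshift\<close> lands in \<open>V m\<close>; the degree of \<open>p\<close> is
  irrelevant.\<close>

lemma shift_in_V: "shift x p \<in> V (Suc m)"
proof -
  have "proj p * monom [x] \<in> V (m + 1)"
    by (intro V_mult proj_in_V) (simp add: monom_in_V)
  then show ?thesis
    using V_mono[OF _ coshift_in_V, of "Suc m" x] by (simp add: shift_def V_add)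
qed

text \<open>Block by block for the splitting into \<open>V m\<close> and its orthogonal complement:
  in the \<open>V m\<close> block the letter crosses by \<open>form_mult_monom\<close>, the mixed
  blocks are exchanged by \<open>form_coshift\<close>, and the last block is zero because
  \<open>coshift\<close> maps into \<open>V m\<close>.\<close>

lemma shift_adjoint: "form L (shift x p) q = form L p (shift (letter_star x) q)"
proof -
  define p' q' where "p' = p - proj p" and "q' = q - proj q"
  have p: "p = proj p + p'" and q: "q = proj q + q'"
    by (simp_all add: p'_def q'_def)
  have orth_left: "form L p' r = 0" if "r \<in> V m" for r
    using that by (simp add: p'_def form_diff_left form_proj)
  have orth_right: "form L r q' = 0" if "r \<in> V m" for r
    using that form_cnj[of q' r] by (simp add: q'_def form_diff_left form_proj)
  have sw: "word_star [x] = [letter_star x]"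
    by (simp add: word_star_def)
  have "form L (shift x p) q = form L (proj p * monom [x]) (proj q + q') + form L (coshift x p') (proj q + q')"
    unfolding shift_def p'_def[symmetric] q[symmetric] by (simp add: form_add_left)
  also have "\<dots> = form L (proj p) (proj q * monom [letter_star x]) + form L (proj p * monom [x]) q'
      + form L p' (proj q * monom [letter_star x])"
    by (simp add: form_add_right orth_right coshift_in_V form_coshift proj_in_V form_mult_monom sw)
  also have "form L (proj p * monom [x]) q' = form L (proj p) (coshift (letter_star x) q')"
    using form_coshift[OF proj_in_V, of "letter_star x" q' p]
      form_cnj[of "coshift (letter_star x) q'" "proj p"] form_cnj[of q' "proj p * monom [x]"]
    by simp
  also have "form L (proj p) (proj q * monom [letter_star x]) + form L (proj p) (coshift (letter_star x) q')
      + form L p' (proj q * monom [letter_star x])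
      = form L (proj p + p') (proj q * monom [letter_star x] + coshift (letter_star x) q')"
    by (simp add: form_add_left form_add_right orth_left coshift_in_V)
  finally show ?thesis
    by (simp add: p[symmetric] shift_def q'_def)
qed

text \<open>As \<open>word_star\<close> reverses the word, the outermost shift on the left becomes
  the innermost on the right, where the induction absorbs it into \<open>q\<close>.\<close>

lemma fold_shift_adjoint:
  "form L (fold shift (word_star w) p) q = form L p (fold shift w q)"
  by (induction w arbitrary: q) (simp_all add: word_star_def shift_adjoint)

lemma fold_shift_in_V: "p \<in> V (Suc m) \<Longrightarrow> fold shift w p \<in> V (Suc m)"
  by (induction w arbitrary: p) (simp_all add: shift_in_V)

text \<open>The last letter is applied last, hence the induction from the right. Each shift meets a
  word of length at most \<open>m\<close>, where it is multiplication, so length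
  \<open>Suc m\<close> is still reached.\<close>

lemma fold_shift_one: "length w \<le> Suc m \<Longrightarrow> fold shift w 1 = monom w"
  by (induction w rule: rev_induct) (simp_all add: monom_Nil shift_eq_mult monom_in_V monom_mult)

section \<open>The extended functional\<close>

definition extension :: "'n free_alg \<Rightarrow> complex"
  where "extension p = (\<Sum>w\<in>keys p. lookup p w * form L (fold shift w 1) 1)"

lemma extension_eq_sum:
  assumes "finite A" "keys p \<subseteq> A"
  shows "extension p = (\<Sum>w\<in>A. lookup p w * form L (fold shift w 1) 1)"
  unfolding extension_def using assms by (intro sum.mono_neutral_left) (auto simp: in_keys_iff)

sublocale ext: free_alg_functional extension
proof
  fix p q :: "'n free_alg" and c
  have "keys (p + q) \<subseteq> keys p \<union> keys q"
    by (rule Poly_Mapping.keys_add)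
  then show "extension (p + q) = extension p + extension q"
    by (simp add: extension_eq_sum[where A = "keys p \<union> keys q"] lookup_add distrib_right
        sum.distrib)
  have "keys (scale c p) \<subseteq> keys p"
    by (auto simp: in_keys_iff)
  then show "extension (scale c p) = c * extension p"
    by (simp add: extension_eq_sum[where A = "keys p"] sum_distrib_left mult.assoc)
qed

lemma extension_monom: "extension (monom w) = form L (fold shift w 1) 1"
  by (simp add: extension_def monom_def)

text \<open>The word \<open>u @ word_star v\<close> first produces \<open>fold shift u 1\<close>;
  the shifts of \<open>word_star v\<close> then cross to the other side by adjointness. The extended
  form thus becomes a Gram form of vectors in \<open>V (Suc m)\<close>.\<close>

lemma form_extension_monom:
  "form extension (monom u) (monom v) = form L (fold shift u 1) (fold shift v 1)"
  by (simp add: ext.form_monom_monom extension_monom fold_shift_adjoint)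

lemma extension_eq:
  assumes "p \<in> V (2 * Suc m)"
  shows "extension p = L p"
proof -
  have "extension (monom w) = L (monom w)" if "w \<in> keys p" for w
  proof -
    \<comment> \<open>Both pieces are short enough for \<open>fold_shift_one\<close>;
      \<open>v\<close> is starred because the form stars its second argument.\<close>
    define u v where "u = take (Suc m) w" and "v = word_star (drop (Suc m) w)"
    have w: "w = u @ word_star v"
      by (simp add: u_def v_def)
    have "length w \<le> 2 * Suc m"
      using assms that by (auto simp: V_iff S_def)
    then have "length u \<le> Suc m" "length v \<le> Suc m"
      by (auto simp: u_def v_def word_star_def)
    then have "form extension (monom u) (monom v) = form L (monom u) (monom v)"
      by (simp add: form_extension_monom fold_shift_one)
    then show ?thesis
      by (simp add: w form_monom_monom ext.form_monom_monom)
  qed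
  then have "(\<Sum>w\<in>keys p. lookup p w * extension (monom w)) = (\<Sum>w\<in>keys p. lookup p w * L (monom w))"
    by simp
  then show ?thesis
    using ext.L_sum[of "\<lambda>w. scale (lookup p w) (monom w)" "keys p"]
      L_sum[of "\<lambda>w. scale (lookup p w) (monom w)" "keys p"]
    by (simp add: sum_scale_monom L_scale ext.L_scale)
qed

lemma psd_extension:
  assumes "psd_on (Suc m) L"
  shows "psd extension"
  unfolding psd_def
proof
  fix p :: "'n free_alg"
  \<comment> \<open>The vector obtained by letting \<open>p\<close> act on \<open>1\<close>. It
    stays in \<open>V (Suc m)\<close> whatever the degree of \<open>p\<close>, so truncated
    positivity applies.\<close>
  define r where "r = (\<Sum>w\<in>keys p. scale (lookup p w) (fold shift w 1))"
  have "extension (p * star p) = form extension p p"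
    by (simp add: form_def)
  also have "\<dots> = form extension (\<Sum>w\<in>keys p. scale (lookup p w) (monom w))
      (\<Sum>w\<in>keys p. scale (lookup p w) (monom w))"
    by (simp add: sum_scale_monom)
  also have "\<dots> = form L r r"
    by (simp only: r_def form_sum_scale ext.form_sum_scale form_extension_monom)
  also have "r \<in> V (Suc m)"
    unfolding r_def
    by (intro V_sum V_scale fold_shift_in_V) (simp add: monom_in_V flip: monom_Nil)
  then have "form L r r \<in> \<real>\<^sub>\<ge>\<^sub>0"
    using assms by (simp add: psd_on_def form_def)
  finally show "extension (p * star p) \<in> \<real>\<^sub>\<ge>\<^sub>0" .
qed

end


section \<open>Truncated functionals\<close>

text \<open>
  Junk values of a functional outside \<open>V m\<close> are replaced by a linear extension by zero, so that its
  form is sesquilinear on the whole algebra.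
\<close>

definition cutoff :: "nat \<Rightarrow> ('n free_alg \<Rightarrow> complex) \<Rightarrow> 'n free_alg \<Rightarrow> complex"
  where "cutoff m L p = (\<Sum>w\<in>S m. lookup p w * L (monom w))"

lemma functional_on_sum:
  assumes "functional_on m L" "finite A" "\<And>i. i \<in> A \<Longrightarrow> f i \<in> V m"
  shows "L (sum f A) = (\<Sum>i\<in>A. L (f i))"
  using assms(2,3)
proof (induction A rule: finite_induct)
  case empty
  have "L (scale 0 0) = 0 * L 0"
    using assms(1) unfolding functional_on_def V_def by (metis fa.span_zero)
  then show ?case by simp
next
  case (insert i A)
  then have "f i \<in> V m" "sum f A \<in> V m"
    by (auto intro: V_sum)
  then have "L (f i + sum f A) = L (f i) + L (sum f A)"
    using assms(1) by (simp add: functional_on_def)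
  with insert show ?case by simp
qed

lemma cutoff_eq:
  fixes L :: "'n::finite free_alg \<Rightarrow> complex"
  assumes "functional_on m L" "p \<in> V m"
  shows "cutoff m L p = L p"
proof -
  have S: "monom w \<in> V m" if "w \<in> S m" for w :: "'n word"
    using that by (simp add: monom_in_V S_def)
  have "L p = L (\<Sum>w\<in>S m. scale (lookup p w) (monom w))"
    using assms(2) by (simp add: sum_scale_monom finite_S V_iff)
  also have "\<dots> = (\<Sum>w\<in>S m. L (scale (lookup p w) (monom w)))"
    using assms(1) by (intro functional_on_sum) (auto simp: finite_S S V_scale)
  also have "\<dots> = cutoff m L p"
    unfolding cutoff_def using assms(1) S by (intro sum.cong) (auto simp: functional_on_def)
  finally show ?thesis by simp
qed

lemma form_cutoff:
  fixes L :: "'n::finite free_alg \<Rightarrow> complex"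
  assumes "functional_on (2 * k) L" "p \<in> V k" "q \<in> V k"
  shows "form (cutoff (2 * k) L) p q = form L p q"
  using V_mult[OF assms(2) V_star[OF assms(3)]] assms(1)
  by (simp add: form_def cutoff_eq mult_2)

lemma hermitian_functional_cutoff:
  fixes L :: "'n::finite free_alg \<Rightarrow> complex"
  assumes "hermitian k L"
  shows "hermitian_functional (cutoff (2 * k) L)"
proof
  fix p q :: "'n free_alg" and c
  show "cutoff (2 * k) L (p + q) = cutoff (2 * k) L p + cutoff (2 * k) L q"
    by (simp add: cutoff_def lookup_add distrib_right sum.distrib)
  show "cutoff (2 * k) L (scale c p) = c * cutoff (2 * k) L p"
    by (simp add: cutoff_def sum_distrib_left mult.assoc)
  have L: "L (monom (word_star w)) = cnj (L (monom w))" if "w \<in> S (2 * k)" for w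
    using assms that unfolding hermitian_def by (simp add: monom_in_V S_def flip: star_monom)
  \<comment> \<open>Reindexing the sum by this permutation matches the coefficients of
    \<open>star p\<close> with those of \<open>p\<close>.\<close>
  have "bij_betw word_star (S (2 * k)) (S (2 * k) :: 'n word set)"
    by (rule bij_betw_byWitness[where f' = word_star]) (auto simp: S_def word_star_def rev_map comp_def)
  then have "cutoff (2 * k) L (star p) =
      (\<Sum>w\<in>S (2 * k). lookup (star p) (word_star w) * L (monom (word_star w)))"
    unfolding cutoff_def by (rule sum.reindex_bij_betw[symmetric])
  then show "cutoff (2 * k) L (star p) = cnj (cutoff (2 * k) L p)"
    by (simp add: cutoff_def lookup_star L)
qed

text \<open>Independence of the tips makes \<open>tip k\<close> injective on the span of
  \<open>P\<close>, which is the kernel.\<close>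

lemma tip_maximal_ker:
  assumes "tip_maximal k L" "p \<in> form_ker k L" "tip k p = 0"
  shows "p = 0"
proof -
  obtain P where P: "finite P" "fa.span P = form_ker k L" "inj_on (tip k) P"
      "fa.independent (tip k ` P)"
    using assms(1) by (auto simp: tip_maximal_def)
  obtain c where c: "p = (\<Sum>v\<in>P. scale (c v) v)"
    using assms(2) P(1,2) fa.span_finite[of P] by auto
  \<comment> \<open>The coefficients are indexed by \<open>P\<close>, while independence speaks of
    tips; injectivity on \<open>P\<close> permits the transfer.\<close>
  define d where "d = (\<lambda>t. c (inv_into P (tip k) t))"
  have "(\<Sum>t\<in>tip k ` P. scale (d t) t) = (\<Sum>v\<in>P. scale (c v) (tip k v))"
    using P(3) by (simp add: sum.reindex d_def)
  also have "\<dots> = tip k p"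
    by (rule poly_mapping_eqI) (simp add: c lookup_sum lookup_tip)
  finally have "\<forall>t\<in>tip k ` P. d t = 0"
    using P(1,4) assms(3) fa.independent_explicit_finite_subsets[of "tip k ` P"] by auto
  then have "\<forall>v\<in>P. c v = 0"
    using P(3) by (simp add: d_def)
  then show ?thesis
    by (simp add: c)
qed

theorem theorem15:
  fixes k :: nat and Lk :: "'n::finite free_alg \<Rightarrow> complex"
  assumes "k \<ge> 1"
    and "functional_on (2 * k) Lk"
    and "psd_on k Lk"
    and "tip_maximal k Lk"
  shows "\<exists>L :: 'n free_alg \<Rightarrow> complex.
    Vector_Spaces.linear scale (*) L \<and> (\<forall>p \<in> V (2 * k). L p = Lk p) \<and> psd L"
proof -
  define \<Lambda> where "\<Lambda> = cutoff (2 * k) Lk"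
  obtain m where k: "k = Suc m"
    using assms(1) by (cases k) auto
  have form_\<Lambda>: "form \<Lambda> p q = form Lk p q" if "p \<in> V k" "q \<in> V k" for p q
    using form_cutoff[OF assms(2) that] by (simp add: \<Lambda>_def)
  have psd_\<Lambda>: "form \<Lambda> p p \<in> \<real>\<^sub>\<ge>\<^sub>0" if "p \<in> V k" for p
    using assms(3) form_\<Lambda>[OF that that] that by (simp add: psd_on_def form_def)
  interpret hermitian_functional \<Lambda>
    using assms(4) hermitian_functional_cutoff by (auto simp: \<Lambda>_def tip_maximal_def)
  interpret definite_functional \<Lambda> m
  proof
    fix p :: "'n free_alg"
    assume p: "p \<in> V m" "form \<Lambda> p p = 0"
    have pk: "p \<in> V k"
      using p(1) by (auto simp: k intro: V_mono[of m])
    \<comment> \<open>Positivity makes an isotropic vector orthogonal to all of \<open>V k\<close>,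
      not only to \<open>V m\<close>.\<close>
    then have "p \<in> form_ker k Lk"
      using form_eq_0_if_isotropic[OF psd_\<Lambda> pk _ p(2)] form_\<Lambda> by (simp add: form_ker_def)
    moreover have "tip k p = 0"
      using p(1) by (intro poly_mapping_eqI) (fastforce simp: lookup_tip V_iff S_def k in_keys_iff)
    ultimately show "p = 0"
      using assms(4) tip_maximal_ker by blast
  qed
  have "psd extension"
    using psd_\<Lambda> by (intro psd_extension) (simp add: psd_on_def form_def k)
  moreover have "\<forall>p \<in> V (2 * k). extension p = Lk p"
    using extension_eq cutoff_eq[OF assms(2)] by (simp add: \<Lambda>_def k)
  ultimately show ?thesis
    using ext.linear_L by blast
qed

end
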